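(* Let $n\ge 1$, let $\alpha=(\alpha_1,\dots,\alpha_n)\in\mathbb{Z}_{>0}^n$, and let $\beta_1,\dots,\beta_n,c$ be natural numbers with $\alpha_1\beta_1=\cdots=\alpha_n\beta_n=c$. Then the quasi-parabolic compactification $T_{para}$ of type $\alpha$ is an admissible quasi-homogeneous compactification of type $\alpha$. In particular, $T_{para}^{-1}=S$, where $S:\mathcal{D}\to\mathbb{R}^n$ is given by $S(x)=y$ with $y_j=\dfrac{x_j}{(1-p(x)^{2c})^{\alpha_j}}$, $j=1,\dots,n$.
   Context: Natural numbers are $\ge 1$. Put $p(y)=\left(y_1^{2\beta_1}+\cdots+y_n^{2\beta_n}\right)^{1/2c}$ for $y\in\mathbb{R}^n$, and $\mathcal{D}=\{x\in\mathbb{R}^n\mid p(x)<1\}$. Quasi-parabolic compactification: for $y\in\mathbb{R}^n\setminus\{0\}$, let $\kappa(y)$ be the unique zero of $F_y(\kappa)=\kappa^{2c}-\kappa^{2c-1}-p(y)^{2c}$ in $\{\kappa>\max\{1,p(y)\}\}$ (such a unique zero exists), and let $\kappa(0)=1$. Equivalently $\kappa(y)=(1-p(x)^{2c})^{-1}$ when $y=S(x)$, $x\in\mathcal{D}$. Define $T_{para}:\mathbb{R}^n\to\mathcal{D}$ by $T_{para}(y)=x$, $x_i=y_i/\kappa(y)^{\alpha_i}$. Admissibility: given a ($C^1$) function $\kappa:\mathbb{R}^n\to\mathbb{R}$, the map $T(y)=x$, $x_i=y_i/\kappa(y)^{\alpha_i}$, is called an admissible quasi-homogeneous compactification of type $\alpha$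 if (A0) $\kappa(y)>p(y)$ for all $y\in\mathbb{R}^n$; (A1) $\kappa(y)\sim p(y)$ as $p(y)\to\infty$; (A2) for each $i$, $(\nabla\kappa(y))_i\sim \dfrac{1}{\alpha_i}\dfrac{y_i^{2\beta_i-1}}{p(y)^{2c-1}}$ as $p(y)\to\infty$; (A3) with $y_\alpha=(\alpha_1y_1,\dots,\alpha_ny_n)^T$, $\langle y_\alpha,\nabla\kappa(y)\rangle<\kappa(y)$ for all $y\in\mathbb{R}^n$. Here $a(y)\sim b(y)$ as $p(y)\to\infty$ means $a(y)=(1+\varepsilon(y))b(y)$ with $\varepsilon(y)\to0$ as $p(y)\to\infty$. *)

theory Defs
  imports "HOL-Analysis.Analysis" "HOL-Library.Landau_Symbols"
begin

text \<open>
  The type \<open>\<alpha>\<close> and the exponents \<open>\<beta>\<close> are families of natural numbers indexed by the finite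
  index type \<open>'n\<close> of \<open>real ^ 'n\<close>; positivity is assumed where the definitions are used.
\<close>

definition qh_p :: "('n::finite \<Rightarrow> nat) \<Rightarrow> nat \<Rightarrow> real ^ 'n \<Rightarrow> real" where
  "qh_p \<beta> c y = root (2 * c) (\<Sum>i\<in>UNIV. (y $ i) ^ (2 * \<beta> i))"

definition qh_D :: "('n::finite \<Rightarrow> nat) \<Rightarrow> nat \<Rightarrow> (real ^ 'n) set" where
  "qh_D \<beta> c = {x. qh_p \<beta> c x < 1}"

definition qh_map :: "('n::finite \<Rightarrow> nat) \<Rightarrow> (real ^ 'n \<Rightarrow> real) \<Rightarrow> real ^ 'n \<Rightarrow> real ^ 'n" where
  "qh_map \<alpha> \<kappa> y = (\<chi> i. y $ i / \<kappa> y ^ \<alpha> i)"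

text \<open>
  The filter of the limit \<open>p(y) \<rightarrow> \<infinity>\<close>. Asymptotic equivalence along it is the library's
  \<^const>\<open>asymp_equiv\<close>; the lemma below confirms that this is the relation
  \<open>a = (1 + \<epsilon>) b\<close> with \<open>\<epsilon> \<rightarrow> 0\<close>, also at points where \<open>b\<close> vanishes.
\<close>

definition at_p_infinity :: "('n::finite \<Rightarrow> nat) \<Rightarrow> nat \<Rightarrow> (real ^ 'n) filter" where
  "at_p_infinity \<beta> c = filtercomap (qh_p \<beta> c) at_top"

lemma asymp_equiv_iff_factor:
  fixes a b :: "'a \<Rightarrow> real"
  shows "a \<sim>[F] b \<longleftrightarrow> (\<exists>\<epsilon>. (\<epsilon> \<longlongrightarrow> 0) F \<and> (\<forall>\<^sub>F y in F. a y = (1 + \<epsilon> y) * b y))"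
proof
  assume ab: "a \<sim>[F] b"
  define q where "q = (\<lambda>y. if a y = 0 \<and> b y = 0 then 1 else a y / b y)"
  have q: "(q \<longlongrightarrow> 1) F"
    using ab by (simp add: asymp_equiv_def q_def)
  have "((\<lambda>y. q y - 1) \<longlongrightarrow> 0) F"
    using tendsto_diff[OF q tendsto_const[of 1]] by simp
  moreover have "\<forall>\<^sub>F y in F. 0 < q y"
    using order_tendstoD(1)[OF q, of 0] by simp
  then have "\<forall>\<^sub>F y in F. a y = (1 + (q y - 1)) * b y"
    by (rule eventually_mono) (auto simp: q_def split: if_splits)
  ultimately show "\<exists>\<epsilon>. (\<epsilon> \<longlongrightarrow> 0) F \<and> (\<forall>\<^sub>F y in F. a y = (1 + \<epsilon> y) * b y)"
    by blast
next
  assume "\<exists>\<epsilon>. (\<epsilon> \<longlongrightarrow> 0) F \<and> (\<forall>\<^sub>F y in F. a y = (1 + \<epsilon> y) * b y)"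
  then obtain \<epsilon> where e: "(\<epsilon> \<longlongrightarrow> 0) F" and eq: "\<forall>\<^sub>F y in F. a y = (1 + \<epsilon> y) * b y"
    by blast
  have lim: "((\<lambda>y. if b y = 0 then 1 else 1 + \<epsilon> y) \<longlongrightarrow> 1) F"
  proof (rule tendstoI)
    fix r :: real assume "0 < r"
    with e have "\<forall>\<^sub>F y in F. dist (\<epsilon> y) 0 < r" by (rule tendstoD)
    then show "\<forall>\<^sub>F y in F. dist (if b y = 0 then 1 else 1 + \<epsilon> y) 1 < r"
      by (rule eventually_mono) (use \<open>0 < r\<close> in \<open>auto simp: dist_real_def\<close>)
  qed
  have "\<forall>\<^sub>F y in F. (if b y = 0 then 1 else 1 + \<epsilon> y) =
                  (if a y = 0 \<and> b y = 0 then 1 else a y / b y)"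
    using eq by (rule eventually_mono) auto
  with lim show "a \<sim>[F] b"
    unfolding asymp_equiv_def by (rule Lim_transform_eventually)
qed

text \<open>
  Admissibility of the map \<open>T\<close> induced by \<open>\<kappa>\<close>. The gradient of \<open>\<kappa>\<close> is the (necessarily unique)
  function \<open>g\<close>; its existence and continuity say that \<open>\<kappa>\<close> is \<open>C\<^sup>1\<close>.
\<close>

definition admissible_qh_compactification ::
  "('n::finite \<Rightarrow> nat) \<Rightarrow> ('n \<Rightarrow> nat) \<Rightarrow> nat \<Rightarrow> (real ^ 'n \<Rightarrow> real) \<Rightarrow>
   (real ^ 'n \<Rightarrow> real ^ 'n) \<Rightarrow> bool" where
  "admissible_qh_compactification \<alpha> \<beta> c \<kappa> T \<longleftrightarrow>
     T = qh_map \<alpha> \<kappa> \<and>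
     (\<exists>g. (\<forall>y. GDERIV \<kappa> y :> g y) \<and> continuous_on UNIV g \<and>
       (\<forall>y. qh_p \<beta> c y < \<kappa> y) \<and>
       \<kappa> \<sim>[at_p_infinity \<beta> c] qh_p \<beta> c \<and>
       (\<forall>i. (\<lambda>y. g y $ i) \<sim>[at_p_infinity \<beta> c]
            (\<lambda>y. 1 / real (\<alpha> i) * ((y $ i) ^ (2 * \<beta> i - 1) / qh_p \<beta> c y ^ (2 * c - 1)))) \<and>
       (\<forall>y. (\<chi> i. real (\<alpha> i) * y $ i) \<bullet> g y < \<kappa> y))"

definition kappa_para :: "('n::finite \<Rightarrow> nat) \<Rightarrow> nat \<Rightarrow> real ^ 'n \<Rightarrow> real" where
  "kappa_para \<beta> c y =
     (if y = 0 then 1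
      else (THE k. max 1 (qh_p \<beta> c y) < k \<and> k ^ (2 * c) - k ^ (2 * c - 1) - qh_p \<beta> c y ^ (2 * c) = 0))"

lemma kappa_para_well_defined:
  fixes y :: "real ^ 'n::finite"
  assumes "y \<noteq> 0" and "0 < c"
  shows "\<exists>!k. max 1 (qh_p \<beta> c y) < k \<and> k ^ (2 * c) - k ^ (2 * c - 1) - qh_p \<beta> c y ^ (2 * c) = 0"
proof -
  define p where "p = qh_p \<beta> c y"
  obtain m where m: "2 * c = Suc m" using \<open>0 < c\<close> by (cases "2 * c") auto
  from \<open>y \<noteq> 0\<close> obtain j where "y $ j \<noteq> 0" by (auto simp: vec_eq_iff)
  then have "0 < (\<Sum>i\<in>UNIV. (y $ i) ^ (2 * \<beta> i))"
    by (intro sum_pos2[where i = j]) (auto simp: power_mult)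
  then have p: "0 < p"
    using \<open>0 < c\<close> by (simp add: p_def qh_p_def)
  define F where "F = (\<lambda>k::real. k ^ m * (k - 1))"
  have F: "k ^ (2 * c) - k ^ (2 * c - 1) - p ^ (2 * c) = F k - p ^ Suc m" for k
    unfolding F_def m by (simp add: algebra_simps)
  have "p ^ m * p \<le> (1 + p) ^ m * p"
    using p by (intro mult_right_mono power_mono) auto
  then have "p ^ Suc m \<le> F (1 + p)" by (simp add: F_def mult.commute)
  moreover have "F 1 \<le> p ^ Suc m" using p by (simp add: F_def)
  moreover have "continuous_on {1..1 + p} F" unfolding F_def by (intro continuous_intros)
  ultimately obtain k where k: "1 \<le> k" "F k = p ^ Suc m"
    using IVT'[of F 1 "p ^ Suc m" "1 + p"] p by auto
  have "k \<noteq> 1" using k p by (auto simp: F_def)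
  with k have k1: "1 < k" by simp
  then have "p ^ Suc m < k ^ Suc m"
    using k(2) zero_less_power[of k m] by (simp add: F_def algebra_simps)
  then have "p < k" using k1 by (intro power_less_imp_less_base[of p "Suc m" k]) auto
  moreover have "F a < F b" if "1 < a" "a < b" for a b
    unfolding F_def using that by (intro mult_le_less_imp_less power_mono) auto
  ultimately show ?thesis
    unfolding p_def[symmetric] F using k k1
    by (intro ex1I[of _ k]) (auto, metis less_irrefl linorder_neqE_linordered_idom)
qed

definition T_para ::
  "('n::finite \<Rightarrow> nat) \<Rightarrow> ('n \<Rightarrow> nat) \<Rightarrow> nat \<Rightarrow> real ^ 'n \<Rightarrow> real ^ 'n" where
  "T_para \<alpha> \<beta> c = qh_map \<alpha> (kappa_para \<beta> c)"

definition S_para ::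
  "('n::finite \<Rightarrow> nat) \<Rightarrow> ('n \<Rightarrow> nat) \<Rightarrow> nat \<Rightarrow> real ^ 'n \<Rightarrow> real ^ 'n" where
  "S_para \<alpha> \<beta> c x = (\<chi> j. x $ j / (1 - qh_p \<beta> c x ^ (2 * c)) ^ \<alpha> j)"

end

theory Submission
  imports Defs
begin

text \<open>
  With \<open>P(y) = p(y)\<^bsup>2c\<^esup>\<close> and \<open>F(k) = k\<^bsup>2c\<^esup> - k\<^bsup>2c-1\<^esup>\<close>, the function \<open>\<kappa>\<close> is
  the solution of \<open>F(\<kappa>(y)) = P(y)\<close> in \<open>[1, \<infinity>)\<close>. Since \<open>F' > 0\<close> on the open half-line to the right of
  \<open>1 - 1/(2c)\<close>, which contains \<open>[1, \<infinity>)\<close>, the function \<open>\<kappa>\<close> is a smooth function of the polynomial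
  \<open>P\<close>, also at the origin. The equation reads \<open>(p/\<kappa>)\<^bsup>2c\<^esup> = 1 - 1/\<kappa>\<close>; this gives the asymptotics,
  and by quasi-homogeneity \<open>P(T y) = 1 - 1/\<kappa>(y)\<close>, from which the inverse is read off.
\<close>

section \<open>The defining equation in one real variable and its differentiable inverse\<close>

definition para_poly :: "nat \<Rightarrow> real \<Rightarrow> real" where
  "para_poly c k = k ^ (2 * c) - k ^ (2 * c - 1)"

text \<open>For \<open>k \<noteq> 0\<close> this is the derivative of \<open>para_poly c\<close>.
  Pulling out \<open>k ^ (2 * c - 1)\<close> leaves a bracket that tends to \<open>2 * c\<close> for
  large \<open>k\<close>, the form used in the asymptotics.\<close>

definition para_deriv :: "nat \<Rightarrow> real \<Rightarrow> real" where
  "para_deriv c k = k ^ (2 * c - 1) * (2 * real c - (2 * real c - 1) / k)"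

lemma power_double_pred:
  fixes k :: "'a::monoid_mult"
  assumes "0 < c"
  shows "k ^ (2 * c) = k * k ^ (2 * c - 1)"
  using assms by (cases c) auto

lemma para_poly_factor:
  assumes "0 < c"
  shows "para_poly c k = k ^ (2 * c - 1) * (k - 1)"
  unfolding para_poly_def power_double_pred[OF assms] by (simp add: algebra_simps)

lemma para_poly_eq_power:
  assumes "0 < c" "k \<noteq> 0"
  shows "para_poly c k = k ^ (2 * c) * (1 - 1 / k)"
  using assms(2) unfolding para_poly_factor[OF assms(1)] power_double_pred[OF assms(1)]
  by (simp add: field_simps)

lemma para_poly_has_derivative:
  assumes "0 < c" "k \<noteq> 0"
  shows "(para_poly c has_real_derivative para_deriv c k) (at k)"
proof -
  obtain d where c: "c = Suc d" using assms by (cases c) auto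
  show ?thesis
    unfolding para_poly_def para_deriv_def c
    by (rule derivative_eq_intros refl | use assms in \<open>simp add: field_simps\<close>)+
qed

text \<open>Up to a positive power of \<open>k\<close> the derivative is
  \<open>2 * c * k - (2 * c - 1)\<close>, and the threshold is its zero.\<close>

lemma para_deriv_pos:
  assumes "0 < c" "1 - 1 / (2 * real c) < k"
  shows "0 < k" "0 < para_deriv c k"
proof -
  have "0 \<le> 1 - 1 / (2 * real c)" using assms by (simp add: field_simps)
  with assms show k: "0 < k" by linarith
  have "2 * real c - 1 < 2 * real c * k" using assms by (simp add: field_simps)
  with k show "0 < para_deriv c k"
    unfolding para_deriv_def by (intro mult_pos_pos) (auto simp: field_simps)
qed

lemma para_poly_strict_mono:
  assumes "0 < c"
  shows "strict_mono_on {1 - 1 / (2 * real c) <..} (para_poly c)"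
proof (rule strict_mono_onI)
  fix a b assume "a \<in> {1 - 1 / (2 * real c) <..}" and "a < b"
  show "para_poly c a < para_poly c b"
  proof (rule DERIV_pos_imp_increasing[OF \<open>a < b\<close>])
    fix x assume "a \<le> x"
    with \<open>a \<in> _\<close> have x: "1 - 1 / (2 * real c) < x" by simp
    show "\<exists>d. DERIV (para_poly c) x :> d \<and> 0 < d"
      using para_deriv_pos[OF assms x] para_poly_has_derivative[OF assms, of x] by blast
  qed
qed

text \<open>The half-line is open and starts to the left of 1, so the value 1 taken by \<kappa> at
  the origin is an interior point and the inverse is differentiable there too.\<close>

definition para_inv :: "nat \<Rightarrow> real \<Rightarrow> real" where
  "para_inv c = the_inv_into {1 - 1 / (2 * real c) <..} (para_poly c)"

lemma para_inv_para_poly: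
  assumes "0 < c" "1 - 1 / (2 * real c) < k"
  shows "para_inv c (para_poly c k) = k"
  unfolding para_inv_def
  using assms strict_mono_on_imp_inj_on[OF para_poly_strict_mono[OF assms(1)]]
  by (intro the_inv_into_f_f) auto

lemma para_inv_has_derivative:
  assumes "0 < c" "1 - 1 / (2 * real c) < k"
  shows "(para_inv c has_real_derivative inverse (para_deriv c k)) (at (para_poly c k))"
  unfolding has_field_derivative_def
proof (rule has_derivative_inverse_strong[where f = "para_poly c" and x = k and S = "{1 - 1 / (2 * real c) <..}"])
  show "(para_poly c has_derivative (*) (para_deriv c k)) (at k)"
    using para_deriv_pos[OF assms] para_poly_has_derivative[OF assms(1), of k]
    by (simp add: has_field_derivative_def)
  show "(*) (para_deriv c k) \<circ> (*) (inverse (para_deriv c k)) = id"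
    using para_deriv_pos[OF assms] by (simp add: fun_eq_iff)
  show "continuous_on {1 - 1 / (2 * real c) <..} (para_poly c)"
    unfolding para_poly_def by (intro continuous_intros)
qed (use assms para_inv_para_poly in auto)

section \<open>The functions \<open>p\<close> and \<kappa>\<close>

lemma qh_p_nonneg: "0 \<le> qh_p \<beta> c y"
  unfolding qh_p_def
  by (cases "c = 0") (auto intro!: real_root_ge_zero sum_nonneg simp: power_mult)

lemma qh_p_power:
  assumes "0 < c"
  shows "qh_p \<beta> c y ^ (2 * c) = (\<Sum>i\<in>UNIV. (y $ i) ^ (2 * \<beta> i))"
  unfolding qh_p_def using assms
  by (intro real_root_pow_pos2) (auto intro!: sum_nonneg simp: power_mult)

lemma qh_p_zero:
  assumes "\<forall>i. 0 < \<beta> i"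
  shows "qh_p \<beta> c 0 = 0"
  unfolding qh_p_def using assms by (subst sum.neutral) auto

text \<open>The value 1 at the origin solves the same equation, because \<open>p\<close> vanishes
  there. Weakening \<open>1 < \<kappa>\<close> to \<open>1 \<le> \<kappa>\<close> thus covers all
  points at once.\<close>

lemma kappa_para_spec:
  fixes y :: "real ^ 'n::finite"
  assumes "\<forall>i. 0 < \<beta> i" "0 < c"
  shows "1 \<le> kappa_para \<beta> c y" "qh_p \<beta> c y < kappa_para \<beta> c y"
    "para_poly c (kappa_para \<beta> c y) = qh_p \<beta> c y ^ (2 * c)"
proof -
  have "1 \<le> kappa_para \<beta> c y \<and> qh_p \<beta> c y < kappa_para \<beta> c y \<and>
    para_poly c (kappa_para \<beta> c y) = qh_p \<beta> c y ^ (2 * c)"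
  proof (cases "y = 0")
    case True
    with assms show ?thesis by (simp add: kappa_para_def qh_p_zero para_poly_def)
  next
    case False
    from theI'[OF kappa_para_well_defined[OF False assms(2), of \<beta>]] False
    show ?thesis by (auto simp: kappa_para_def para_poly_def)
  qed
  then show "1 \<le> kappa_para \<beta> c y" "qh_p \<beta> c y < kappa_para \<beta> c y"
    "para_poly c (kappa_para \<beta> c y) = qh_p \<beta> c y ^ (2 * c)" by auto
qed

lemma kappa_para_gt:
  assumes "\<forall>i. 0 < \<beta> i" "0 < c"
  shows "1 - 1 / (2 * real c) < kappa_para \<beta> c y"
proof -
  have "0 < 1 / (2 * real c)" using assms by simp
  with kappa_para_spec(1)[OF assms, of y] show ?thesis by linarith
qed

text \<open>Both numbers lie where \<open>para_inv c\<close> inverts \<open>para_poly c\<close>.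
  Admitting \<open>k = 1\<close> spares a case distinction at the origin.\<close>

lemma kappa_para_unique:
  assumes "\<forall>i. 0 < \<beta> i" "0 < c"
    and "1 \<le> k" "para_poly c k = qh_p \<beta> c y ^ (2 * c)"
  shows "kappa_para \<beta> c y = k"
proof -
  have "0 < 1 / (2 * real c)" using assms by simp
  then have "1 - 1 / (2 * real c) < k" using assms by linarith
  then show ?thesis
    using para_inv_para_poly[OF assms(2)] kappa_para_gt[OF assms(1,2), of y]
      kappa_para_spec(3)[OF assms(1,2), of y] assms(4) by metis
qed

lemma qh_p_power_over_kappa:
  assumes "\<forall>i. 0 < \<beta> i" "0 < c"
  shows "qh_p \<beta> c y ^ (2 * c) / kappa_para \<beta> c y ^ (2 * c) = 1 - 1 / kappa_para \<beta> c y"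
proof -
  have "0 < kappa_para \<beta> c y" using kappa_para_spec(1)[OF assms, of y] by linarith
  then show ?thesis
    by (simp add: para_poly_eq_power[OF assms(2)] flip: kappa_para_spec(3)[OF assms])
qed

section \<open>The gradient of \<kappa>\<close>

text \<open>Implicit differentiation of \<open>F(\<kappa>(y)) = P(y)\<close> gives this formula: the
  gradient of \<open>P\<close> divided by \<open>F'(\<kappa>)\<close>.\<close>

definition kappa_grad :: "('n::finite \<Rightarrow> nat) \<Rightarrow> nat \<Rightarrow> real ^ 'n \<Rightarrow> real ^ 'n" where
  "kappa_grad \<beta> c y =
     (\<chi> i. 2 * real (\<beta> i) * (y $ i) ^ (2 * \<beta> i - 1) / para_deriv c (kappa_para \<beta> c y))"

lemma kappa_para_gderiv:
  fixes y :: "real ^ 'n::finite"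
  assumes "\<forall>i. 0 < \<beta> i" "0 < c"
  shows "GDERIV (kappa_para \<beta> c) y :> kappa_grad \<beta> c y"
proof -
  \<comment> \<open>As a composition on the whole space, \<kappa> is open to the chain rule at every
    point, including the origin.\<close>
  have eq: "kappa_para \<beta> c = (\<lambda>y. para_inv c (\<Sum>i\<in>UNIV. (y $ i) ^ (2 * \<beta> i)))"
    using para_inv_para_poly[OF assms(2) kappa_para_gt[OF assms]]
    by (simp add: fun_eq_iff kappa_para_spec(3)[OF assms] qh_p_power[OF assms(2)])
  have P: "((\<lambda>y. \<Sum>i\<in>UNIV. (y $ i) ^ (2 * \<beta> i)) has_derivative
      (\<lambda>h. \<Sum>i\<in>UNIV. real (2 * \<beta> i) * (h $ i) * (y $ i) ^ (2 * \<beta> i - 1))) (at y)"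
    by (auto intro!: derivative_eq_intros bounded_linear.has_derivative[OF bounded_linear_vec_nth])
  have "(para_inv c has_real_derivative inverse (para_deriv c (kappa_para \<beta> c y)))
      (at (\<Sum>i\<in>UNIV. (y $ i) ^ (2 * \<beta> i)))"
    using para_inv_has_derivative[OF assms(2) kappa_para_gt[OF assms, of y]]
    by (simp add: kappa_para_spec(3)[OF assms] qh_p_power[OF assms(2)])
  then have "(para_inv c has_derivative (*) (inverse (para_deriv c (kappa_para \<beta> c y))))
      (at (\<Sum>i\<in>UNIV. (y $ i) ^ (2 * \<beta> i)))"
    by (simp add: has_field_derivative_def)
  from has_derivative_compose[OF P this] show ?thesis
    unfolding gderiv_def eq[symmetric]
    by (simp add: inner_vec_def kappa_grad_def sum_distrib_left field_simps)
qed

lemma continuous_on_kappa_grad: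
  assumes "\<forall>i. 0 < \<beta> i" "0 < c"
  shows "continuous_on UNIV (kappa_grad \<beta> c)"
proof -
  have "continuous_on UNIV (kappa_para \<beta> c)"
    using kappa_para_gderiv[OF assms] has_derivative_continuous
    unfolding gderiv_def by (intro continuous_at_imp_continuous_on) blast
  moreover have "kappa_para \<beta> c y \<noteq> 0" "para_deriv c (kappa_para \<beta> c y) \<noteq> 0" for y
    using para_deriv_pos[OF assms(2) kappa_para_gt[OF assms, of y]] by auto
  ultimately show ?thesis
    unfolding kappa_grad_def para_deriv_def
    by (intro continuous_intros) auto
qed

section \<open>Asymptotics as \<open>p\<close> tends to infinity\<close>

lemma filterlim_qh_p: "filterlim (qh_p \<beta> c) at_top (at_p_infinity \<beta> c)"
  unfolding at_p_infinity_def by (rule filterlim_filtercomap)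

lemma inverse_kappa_para_tendsto_0:
  assumes "\<forall>i. 0 < \<beta> i" "0 < c"
  shows "((\<lambda>y. 1 / kappa_para \<beta> c y) \<longlongrightarrow> 0) (at_p_infinity \<beta> c)"
proof -
  have "filterlim (kappa_para \<beta> c) at_top (at_p_infinity \<beta> c)"
    using filterlim_qh_p
    by (rule filterlim_at_top_mono) (simp add: kappa_para_spec(2)[OF assms] less_imp_le)
  from tendsto_inverse_0_at_top[OF this] show ?thesis by (simp add: inverse_eq_divide)
qed

lemma kappa_para_asymp_equiv:
  assumes "\<forall>i. 0 < \<beta> i" "0 < c"
  shows "kappa_para \<beta> c \<sim>[at_p_infinity \<beta> c] qh_p \<beta> c"
proof -
  \<comment> \<open>The quotient is taken this way up because it is an explicit function of
    \<open>1 / \<kappa>\<close>. It is nonnegative, so the root undoes the power.\<close>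
  have quot: "qh_p \<beta> c y / kappa_para \<beta> c y = root (2 * c) (1 - 1 / kappa_para \<beta> c y)" for y
  proof -
    have "0 \<le> qh_p \<beta> c y / kappa_para \<beta> c y"
      using kappa_para_spec(1)[OF assms, of y] qh_p_nonneg[of \<beta> c y] by simp
    then show ?thesis
      using assms(2) by (simp flip: qh_p_power_over_kappa[OF assms] power_divide
          add: real_root_power_cancel)
  qed
  have "((\<lambda>y. root (2 * c) (1 - 1 / kappa_para \<beta> c y)) \<longlongrightarrow> root (2 * c) (1 - 0))
      (at_p_infinity \<beta> c)"
    by (intro tendsto_intros inverse_kappa_para_tendsto_0 assms)
  then have "((\<lambda>y. qh_p \<beta> c y / kappa_para \<beta> c y) \<longlongrightarrow> 1) (at_p_infinity \<beta> c)"
    using assms(2) by (simp add: quot)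
  then have "qh_p \<beta> c \<sim>[at_p_infinity \<beta> c] kappa_para \<beta> c"
    by (rule asymp_equivI')
  then show ?thesis by (rule asymp_equiv_symI)
qed

lemma kappa_grad_asymp_equiv:
  assumes "\<forall>i. 0 < \<beta> i" "0 < c" "\<forall>i. \<alpha> i * \<beta> i = c"
  shows "(\<lambda>y. kappa_grad \<beta> c y $ i) \<sim>[at_p_infinity \<beta> c]
    (\<lambda>y. 1 / real (\<alpha> i) * ((y $ i) ^ (2 * \<beta> i - 1) / qh_p \<beta> c y ^ (2 * c - 1)))"
proof -
  have "((\<lambda>y. 2 * real c - (2 * real c - 1) * (1 / kappa_para \<beta> c y)) \<longlongrightarrow>
      2 * real c - (2 * real c - 1) * 0) (at_p_infinity \<beta> c)"
    by (intro tendsto_intros inverse_kappa_para_tendsto_0 assms)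
  then have "(\<lambda>y. 2 * real c - (2 * real c - 1) / kappa_para \<beta> c y)
      \<sim>[at_p_infinity \<beta> c] (\<lambda>_. 2 * real c)"
    using assms(2) by (intro tendsto_imp_asymp_equiv_const) auto
  then have "(\<lambda>y. para_deriv c (kappa_para \<beta> c y)) \<sim>[at_p_infinity \<beta> c]
      (\<lambda>y. qh_p \<beta> c y ^ (2 * c - 1) * (2 * real c))"
    unfolding para_deriv_def
    by (intro asymp_equiv_mult asymp_equiv_power kappa_para_asymp_equiv assms)
  \<comment> \<open>Only the denominator is replaced; the numerator, which may vanish, stays the
    same on both sides.\<close>
  then have "(\<lambda>y. 2 * real (\<beta> i) * (y $ i) ^ (2 * \<beta> i - 1) / para_deriv c (kappa_para \<beta> c y))
      \<sim>[at_p_infinity \<beta> c] (\<lambda>y. 2 * real (\<beta> i) * (y $ i) ^ (2 * \<beta> i - 1) /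
        (qh_p \<beta> c y ^ (2 * c - 1) * (2 * real c)))"
    by (intro asymp_equiv_divide asymp_equiv_refl)
  moreover have "real (\<beta> i) / real c = 1 / real (\<alpha> i)"
    using spec[OF assms(1), of i] by (simp flip: spec[OF assms(3), of i])
  then have "2 * real (\<beta> i) * a / (b * (2 * real c)) = 1 / real (\<alpha> i) * (a / b)" for a b
    by (metis mult_divide_mult_cancel_left_if times_divide_times_eq mult.commute
        mult.assoc zero_neq_numeral)
  ultimately show ?thesis by (simp add: kappa_grad_def)
qed

text \<open>Euler's identity for the quasi-homogeneous \<open>P\<close> turns the inner product into
  \<open>2c F(\<kappa>) / F'(\<kappa>)\<close>. The bound then follows from
  \<open>\<kappa> F'(\<kappa>) - 2c F(\<kappa>) = \<kappa>^(2c-1) > 0\<close>.\<close>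

lemma kappa_grad_inner_less:
  fixes y :: "real ^ 'n::finite"
  assumes "\<forall>i. 0 < \<beta> i" "0 < c" "\<forall>i. \<alpha> i * \<beta> i = c"
  shows "(\<chi> i. real (\<alpha> i) * y $ i) \<bullet> kappa_grad \<beta> c y < kappa_para \<beta> c y"
proof -
  define k where "k = kappa_para \<beta> c y"
  have k: "1 \<le> k" and Pk: "para_poly c k = (\<Sum>i\<in>UNIV. (y $ i) ^ (2 * \<beta> i))"
    using kappa_para_spec[OF assms(1,2), of y] qh_p_power[OF assms(2), of \<beta> y]
    by (auto simp: k_def)
  have pos: "0 < para_deriv c k"
    unfolding k_def by (intro para_deriv_pos kappa_para_gt assms)
  have "real (\<alpha> i) * y $ i * (2 * real (\<beta> i) * (y $ i) ^ (2 * \<beta> i - 1) / d) =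
      2 * real c / d * (y $ i) ^ (2 * \<beta> i)" for i d
    using power_double_pred[OF spec[OF assms(1), of i], of "y $ i"] by (simp flip: spec[OF assms(3), of i])
  note this[of _ "para_deriv c k"]
  then have "(\<chi> i. real (\<alpha> i) * y $ i) \<bullet> kappa_grad \<beta> c y = 2 * real c * para_poly c k / para_deriv c k"
    unfolding Pk by (simp add: inner_vec_def kappa_grad_def k_def[symmetric] sum_distrib_left sum_divide_distrib del: times_divide_eq_right)
  also have "\<dots> < k"
  proof -
    have "k * para_deriv c k - 2 * real c * para_poly c k = k ^ (2 * c - 1)"
      using k by (simp add: para_deriv_def para_poly_factor[OF assms(2)] field_simps)
    moreover have "0 < k ^ (2 * c - 1)" using k by simp
    ultimately have "2 * real c * para_poly c k < k * para_deriv c k" by linarith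
    then show ?thesis using pos by (simp add: field_simps)
  qed
  finally show ?thesis by (simp add: k_def)
qed

section \<open>Quasi-homogeneity and the inverse map\<close>

lemma qh_p_scale:
  fixes x :: "real ^ 'n::finite"
  assumes "0 < c" "\<forall>i. \<alpha> i * \<beta> i = c"
  shows "qh_p \<beta> c (\<chi> i. x $ i / k ^ \<alpha> i) ^ (2 * c) = qh_p \<beta> c x ^ (2 * c) / k ^ (2 * c)"
proof -
  have "(k ^ \<alpha> i) ^ (2 * \<beta> i) = k ^ (2 * c)" for i
    using spec[OF assms(2), of i] by (metis mult.left_commute power_mult)
  then show ?thesis
    by (simp add: qh_p_power[OF assms(1)] power_divide sum_divide_distrib)
qed

lemma mem_qh_D_iff:
  assumes "0 < c"
  shows "x \<in> qh_D \<beta> c \<longleftrightarrow> qh_p \<beta> c x ^ (2 * c) < 1"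
  using assms qh_p_nonneg[of \<beta> c x] by (simp add: qh_D_def power_less_one_iff)

lemma qh_p_T_para:
  assumes "\<forall>i. 0 < \<beta> i" "0 < c" "\<forall>i. \<alpha> i * \<beta> i = c"
  shows "qh_p \<beta> c (T_para \<alpha> \<beta> c y) ^ (2 * c) = 1 - 1 / kappa_para \<beta> c y"
  by (simp add: T_para_def qh_map_def qh_p_scale[OF assms(2,3)]
      qh_p_power_over_kappa[OF assms(1,2)])

lemma T_para_in_qh_D:
  assumes "\<forall>i. 0 < \<beta> i" "0 < c" "\<forall>i. \<alpha> i * \<beta> i = c"
  shows "T_para \<alpha> \<beta> c y \<in> qh_D \<beta> c"
  using kappa_para_spec(1)[OF assms(1,2), of y]
  by (simp add: mem_qh_D_iff[OF assms(2)] qh_p_T_para[OF assms])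

text \<open>At \<open>T y\<close> the base of the denominators in \<open>S_para\<close> is
  \<open>1 / \<kappa>(y)\<close>, so dividing by its powers restores the factors
  \<open>\<kappa>(y) ^ \<alpha> i\<close>.\<close>

lemma S_para_T_para:
  assumes "\<forall>i. 0 < \<beta> i" "0 < c" "\<forall>i. \<alpha> i * \<beta> i = c"
  shows "S_para \<alpha> \<beta> c (T_para \<alpha> \<beta> c y) = y"
  using kappa_para_spec(1)[OF assms(1,2), of y]
  by (simp add: S_para_def qh_p_T_para[OF assms] power_one_over vec_eq_iff)
    (simp add: T_para_def qh_map_def)

lemma T_para_S_para:
  assumes "\<forall>i. 0 < \<beta> i" "0 < c" "\<forall>i. \<alpha> i * \<beta> i = c" "x \<in> qh_D \<beta> c"
  shows "T_para \<alpha> \<beta> c (S_para \<alpha> \<beta> c x) = x"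
proof -
  \<comment> \<open>This number turns out to be the reciprocal of \<kappa> at \<open>S x\<close>;
    \<open>d \<le> 1\<close> makes \<open>1 / d\<close> at least 1, as uniqueness requires.\<close>
  define d where "d = 1 - qh_p \<beta> c x ^ (2 * c)"
  have "0 \<le> qh_p \<beta> c x ^ (2 * c)" using qh_p_nonneg by simp
  then have d: "0 < d" "d \<le> 1"
    using assms(4) by (auto simp: d_def mem_qh_D_iff[OF assms(2)])
  have S: "S_para \<alpha> \<beta> c x = (\<chi> i. x $ i / d ^ \<alpha> i)"
    by (simp add: S_para_def d_def)
  have "qh_p \<beta> c (S_para \<alpha> \<beta> c x) ^ (2 * c) = (1 - d) / d ^ (2 * c)"
    unfolding S qh_p_scale[OF assms(2,3)] by (simp add: d_def)
  \<comment> \<open>With \<open>k = 1 / d\<close>, the right-hand side of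
    \<open>F(k) = k^(2c) (1 - 1/k)\<close> is \<open>(1 - d) / d^(2c)\<close>.\<close>
  also have "\<dots> = para_poly c (1 / d)"
    using d by (simp add: para_poly_eq_power[OF assms(2)] power_one_over)
  finally have "kappa_para \<beta> c (S_para \<alpha> \<beta> c x) = 1 / d"
    using d by (intro kappa_para_unique assms) auto
  then show ?thesis
    using d by (simp add: T_para_def qh_map_def S vec_eq_iff power_one_over)
qed

theorem theorem2p10:
  fixes \<alpha> \<beta> :: "'n::finite \<Rightarrow> nat" and c :: nat
  assumes "\<And>i. 0 < \<alpha> i" and "\<And>i. 0 < \<beta> i" and "0 < c"
    and "\<And>i. \<alpha> i * \<beta> i = c"
  shows "admissible_qh_compactification \<alpha> \<beta> c (kappa_para \<beta> c) (T_para \<alpha> \<beta> c) \<and>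
    bij_betw (T_para \<alpha> \<beta> c) UNIV (qh_D \<beta> c) \<and>
    (\<forall>x\<in>qh_D \<beta> c. inv (T_para \<alpha> \<beta> c) x = S_para \<alpha> \<beta> c x)"
proof (intro conjI ballI)
  have b: "\<forall>i. 0 < \<beta> i" and ab: "\<forall>i. \<alpha> i * \<beta> i = c" using assms by auto
  note bc = b assms(3) and abc = b assms(3) ab
  show "admissible_qh_compactification \<alpha> \<beta> c (kappa_para \<beta> c) (T_para \<alpha> \<beta> c)"
    unfolding admissible_qh_compactification_def
    using kappa_para_gderiv[OF bc] continuous_on_kappa_grad[OF bc] kappa_para_spec(2)[OF bc]
      kappa_para_asymp_equiv[OF bc] kappa_grad_asymp_equiv[OF abc] kappa_grad_inner_less[OF abc]
    by (intro conjI exI[of _ "kappa_grad \<beta> c"]) (auto simp: T_para_def)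
  show bij: "bij_betw (T_para \<alpha> \<beta> c) UNIV (qh_D \<beta> c)"
    by (rule bij_betw_byWitness[where f' = "S_para \<alpha> \<beta> c"])
      (use S_para_T_para[OF abc] T_para_S_para[OF abc] T_para_in_qh_D[OF abc] in auto)
  fix x assume "x \<in> qh_D \<beta> c"
  then show "inv (T_para \<alpha> \<beta> c) x = S_para \<alpha> \<beta> c x"
    \<comment> \<open>Injectivity ensures that the preimage chosen by \<open>inv\<close> is
      \<open>S x\<close>.\<close>
    using bij T_para_S_para[OF abc] by (intro inv_f_eq) (auto simp: bij_betw_def)
qed

end
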